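(* Let $H\in(0,1/2]$ and let $\mathbf{B}^H=\{\mathbf{B}^H_U;\,U\in\mathcal{A}\}$ be a set-indexed fractional Brownian motion of index $H$. Then $\mathbf{B}^H$ is $\mathcal{C}_0$-increment stationary, i.e. for all $C,C'\in\mathcal{C}_0$ such that $m(C)=m(C')$, the random variables $\Delta\mathbf{B}^H_C$ and $\Delta\mathbf{B}^H_{C'}$ have the same law.
   Context: $\mathcal{T}$ is a locally compact complete separable metric space with a Borel measure $m$. $\overline{(\cdot)}$ and $(\cdot)^\circ$ denote closure and interior. For a class $\mathcal{D}$ of sets, $\mathcal{D}(u)$ is the class of finite unions of members of $\mathcal{D}$. $\mathcal{A}$ is an indexing collection, i.e. a nonempty class of compact connected subsets of $\mathcal{T}$ such that: (1) $\emptyset\in\mathcal{A}$; $A^\circ\ne A$ if $A\in\mathcal{A}$, $A\notin\{\emptyset,\mathcal{T}\}$; there is an increasing sequence $(B_n)$ in $\mathcal{A}(u)$ with $\mathcal{T}=\bigcup_n B_n^\circ$. (2) $\mathcal{A}$ is closed under arbitrary intersections, and if $A,B\in\mathcal{A}$ are nonempty then $A\cap B\neq\emptyset$; if $(A_i)$ is an increasing sequence in $\mathcal{A}$ and there is $n$ with $A_i\subseteq B_n$ for all $i$, then $\overline{\bigcup_iA_i}\in\mathcal{A}$. (3) $\sigma(\mathcal{A})$ is the Borel $\sigma$-algebra of $\mathcal{T}$. (4) There are an increasing sequence of finite subclasses $\mathcal{A}_n\subseteq\mathcal{A}$ closed under intersections with $\emptyset,B_n\in\mathcal{A}_n(u)$,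 and functions $g_n:\mathcal{A}\to\mathcal{A}_n(u)\cup\{\mathcal{T}\}$ such that: (a) $g_n$ preserves arbitrary intersections and finite unions (i.e. $g_n(\bigcap_{A\in\mathcal{A}'}A)=\bigcap_{A\in\mathcal{A}'}g_n(A)$ for $\mathcal{A}'\subseteq\mathcal{A}$, and $\bigcup_{i=1}^kA_i=\bigcup_{j=1}^lA'_j$ implies $\bigcup_{i=1}^kg_n(A_i)=\bigcup_{j=1}^lg_n(A'_j)$); (b) $A\subseteq(g_n(A))^\circ$ for $A\in\mathcal{A}$; (c) $g_n(A)\subseteq g_k(A)$ if $n\ge k$; (d) $A=\bigcap_ng_n(A)$; (e) for $A,A'\in\mathcal{A}$, $g_n(A)\cap A'\in\mathcal{A}$, and if $A'\in\mathcal{A}_n$ then $g_n(A)\cap A'\in\mathcal{A}_n$; (f) $g_n(\emptyset)=\emptyset$. (5) Every countable intersection of sets in $\mathcal{A}(u)$ is the closure of a countable union of sets in $\mathcal{A}$. It is understood that $m(U)<\infty$ for $U\in\mathcal{A}$. A set-indexed fractional Brownian motion (sifBm) of index $H\in(0,1/2]$ is a mean-zero Gaussian process $\{\mathbf{B}^H_U;\,U\in\mathcal{A}\}$ with $E[\mathbf{B}^H_U\mathbf{B}^H_V]=\frac12\left[m(U)^{2H}+m(V)^{2H}-m(U\bigtriangleup V)^{2H}\right]$ for $U,V\in\mathcal{A}$, where $\bigtriangleup$ is symmetric difference. $\mathcal{C}_0=\{U\setminus V;\,U,V\in\mathcal{A}\}$. For a set-indexed process $X=\{X_U;U\in\mathcal{A}\}$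 and $C=U\setminus V\in\mathcal{C}_0$, the increment is $\Delta X_C=X_U-X_{U\cap V}$. *)

theory Defs
  imports "HOL-Probability.Probability"
begin

text \<open>The class \<open>\<D>(u)\<close>. Unions are over at least one member, so that \<open>{}\<close> is
  a member of \<open>\<D>(u)\<close> only if it is one of \<open>\<D>\<close>.\<close>

definition finite_unions :: "'a set set \<Rightarrow> 'a set set" where
  "finite_unions \<D> = {\<Union>\<F> |\<F>. \<F> \<subseteq> \<D> \<and> finite \<F> \<and> \<F> \<noteq> {}}"

text \<open>The ambient space \<open>\<T>\<close> is the whole type. Intersections of subfamilies of \<open>\<A>\<close> are
  over nonempty subfamilies: the empty one would put \<open>UNIV\<close> into \<open>\<A>\<close>.\<close>

locale indexing_structure =
  fixes \<A> :: "'a :: polish_space set set"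
    and B :: "nat \<Rightarrow> 'a set"
    and An :: "nat \<Rightarrow> 'a set set"
    and g :: "nat \<Rightarrow> 'a set \<Rightarrow> 'a set"
  assumes nonempty: "\<A> \<noteq> {}"
    and compact: "A \<in> \<A> \<Longrightarrow> compact A"
    and connected: "A \<in> \<A> \<Longrightarrow> connected A"
    and empty_mem: "{} \<in> \<A>"
    and interior_neq: "A \<in> \<A> \<Longrightarrow> A \<notin> {{}, UNIV} \<Longrightarrow> interior A \<noteq> A"
    and B_mem: "B n \<in> finite_unions \<A>"
    and B_incseq: "incseq B"
    and B_exhausts: "(\<Union>n. interior (B n)) = UNIV"
    and Inter_mem: "\<A>' \<subseteq> \<A> \<Longrightarrow> \<A>' \<noteq> {} \<Longrightarrow> \<Inter>\<A>' \<in> \<A>"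
    and Int_nonempty: "A \<in> \<A> \<Longrightarrow> A' \<in> \<A> \<Longrightarrow> A \<noteq> {} \<Longrightarrow> A' \<noteq> {} \<Longrightarrow> A \<inter> A' \<noteq> {}"
    and closure_UN_mem:
      "incseq S \<Longrightarrow> (\<And>i. S i \<in> \<A>) \<Longrightarrow> (\<And>i. S i \<subseteq> B n) \<Longrightarrow> closure (\<Union>i. S i) \<in> \<A>"
    and generates_borel: "sigma_sets UNIV \<A> = sets borel"
    and An_incseq: "incseq An"
    and An_finite: "finite (An n)"
    and An_subset: "An n \<subseteq> \<A>"
    and An_Int: "A \<in> An n \<Longrightarrow> A' \<in> An n \<Longrightarrow> A \<inter> A' \<in> An n"
    and An_empty: "{} \<in> finite_unions (An n)"
    and An_B: "B n \<in> finite_unions (An n)"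
    and g_mem: "A \<in> \<A> \<Longrightarrow> g n A \<in> finite_unions (An n) \<union> {UNIV}"
    and g_Inter: "\<A>' \<subseteq> \<A> \<Longrightarrow> \<A>' \<noteq> {} \<Longrightarrow> g n (\<Inter>\<A>') = (\<Inter>A\<in>\<A>'. g n A)"
    and g_Union: "\<F> \<subseteq> \<A> \<Longrightarrow> finite \<F> \<Longrightarrow> \<F> \<noteq> {} \<Longrightarrow> \<F>' \<subseteq> \<A> \<Longrightarrow> finite \<F>' \<Longrightarrow> \<F>' \<noteq> {} \<Longrightarrow>
      \<Union>\<F> = \<Union>\<F>' \<Longrightarrow> (\<Union>A\<in>\<F>. g n A) = (\<Union>A\<in>\<F>'. g n A)"
    and g_interior: "A \<in> \<A> \<Longrightarrow> A \<subseteq> interior (g n A)"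
    and g_antimono: "A \<in> \<A> \<Longrightarrow> k \<le> n \<Longrightarrow> g n A \<subseteq> g k A"
    and g_approx: "A \<in> \<A> \<Longrightarrow> (\<Inter>n. g n A) = A"
    and g_Int_mem: "A \<in> \<A> \<Longrightarrow> A' \<in> \<A> \<Longrightarrow> g n A \<inter> A' \<in> \<A>"
    and g_Int_An: "A \<in> \<A> \<Longrightarrow> A' \<in> An n \<Longrightarrow> g n A \<inter> A' \<in> An n"
    and g_empty: "g n {} = {}"
    and countable_Inter: "\<S> \<subseteq> finite_unions \<A> \<Longrightarrow> countable \<S> \<Longrightarrow> \<S> \<noteq> {} \<Longrightarrow>
      \<exists>\<D>. \<D> \<subseteq> \<A> \<and> countable \<D> \<and> \<Inter>\<S> = closure (\<Union>\<D>)"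

definition indexing_collection :: "'a :: polish_space set set \<Rightarrow> bool" where
  "indexing_collection \<A> \<longleftrightarrow> (\<exists>B An g. indexing_structure \<A> B An g)"

text \<open>Point masses count as (degenerate) normal laws; a Gaussian process may have constant
  coordinates.\<close>

definition normal_law :: "real measure \<Rightarrow> bool" where
  "normal_law N \<longleftrightarrow>
     (\<exists>\<mu>. N = return borel \<mu>) \<or>
     (\<exists>\<mu> \<sigma>. \<sigma> > 0 \<and> N = density lborel (normal_density \<mu> \<sigma>))"

text \<open>The finite-dimensional laws are multivariate normal, i.e. every linear combination of
  finitely many coordinates is normal.\<close>

definition gaussian_process :: "'w measure \<Rightarrow> 'i set \<Rightarrow> ('i \<Rightarrow> 'w \<Rightarrow> real) \<Rightarrow> bool" where
  "gaussian_process P I X \<longleftrightarrow> prob_space P \<and> (\<forall>i\<in>I. X i \<in> borel_measurable P) \<and>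
     (\<forall>J c. finite J \<and> J \<subseteq> I \<longrightarrow> normal_law (distr P borel (\<lambda>\<omega>. \<Sum>i\<in>J. c i * X i \<omega>)))"

definition sifBm ::
  "'w measure \<Rightarrow> 'a measure \<Rightarrow> 'a set set \<Rightarrow> real \<Rightarrow> ('a set \<Rightarrow> 'w \<Rightarrow> real) \<Rightarrow> bool" where
  "sifBm P m \<A> H X \<longleftrightarrow> gaussian_process P \<A> X \<and>
     (\<forall>U\<in>\<A>. prob_space.expectation P (X U) = 0) \<and>
     (\<forall>U\<in>\<A>. \<forall>V\<in>\<A>. prob_space.expectation P (\<lambda>\<omega>. X U \<omega> * X V \<omega>) =
        1/2 * (measure m U powr (2 * H) + measure m V powr (2 * H)
               - measure m (sym_diff U V) powr (2 * H)))"

definition C0 :: "'a set set \<Rightarrow> 'a set set" where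
  "C0 \<A> = {U - V |U V. U \<in> \<A> \<and> V \<in> \<A>}"

text \<open>A member \<open>C\<close> of \<open>C0 \<A>\<close> may have several representations \<open>U - V\<close>, so the increment
  is a relation: \<open>D\<close> is an increment over \<open>C\<close> if it is one for some representation.\<close>

definition is_increment ::
  "'a set set \<Rightarrow> ('a set \<Rightarrow> 'w \<Rightarrow> real) \<Rightarrow> 'a set \<Rightarrow> ('w \<Rightarrow> real) \<Rightarrow> bool" where
  "is_increment \<A> X C D \<longleftrightarrow>
     (\<exists>U\<in>\<A>. \<exists>V\<in>\<A>. C = U - V \<and> D = (\<lambda>\<omega>. X U \<omega> - X (U \<inter> V) \<omega>))"

text \<open>Increments over sets of equal measure have the same law, whichever representations of
  the sets are used.\<close>

definition C0_increment_stationary ::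
  "'w measure \<Rightarrow> 'a measure \<Rightarrow> 'a set set \<Rightarrow> ('a set \<Rightarrow> 'w \<Rightarrow> real) \<Rightarrow> bool" where
  "C0_increment_stationary P m \<A> X \<longleftrightarrow>
     (\<forall>C\<in>C0 \<A>. \<forall>C'\<in>C0 \<A>. emeasure m C = emeasure m C' \<longrightarrow>
       (\<forall>D D'. is_increment \<A> X C D \<and> is_increment \<A> X C' D' \<longrightarrow>
          distr P borel D = distr P borel D'))"

end

theory Submission
  imports Defs
begin

text \<open>An increment \<open>X U - X (U \<inter> V)\<close> is a linear combination of coordinates of a
  Gaussian process, so its law is normal, and it has mean \<open>0\<close>. A centred normal law is
  determined by its second moment (lemma \<open>centred_normal_law_eq\<close>). For sets \<open>U\<close> and \<open>W\<close> of the
  class, expanding the square in \<open>E[(X U - X W)\<^sup>2]\<close> makes the powers of \<open>m(U)\<close> and \<open>m(W)\<close> in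
  the covariance cancel, and what is left is \<open>m(U \<triangle> W)\<close> to the power \<open>2H\<close> (lemma
  \<open>sifBm_diff_moments\<close>). With \<open>W = U \<inter> V\<close> the symmetric difference is \<open>U - V\<close> itself, so that
  the second moment depends only on \<open>m(U - V)\<close>: neither the representation of the set nor the set
  itself matters.\<close>

text \<open>Square integrability of the coordinates makes it legitimate to expand the second moment
  of an increment by linearity. For a nondegenerate normal law it follows from the integrability
  of the centred powers \<open>(x - \<mu>) ^ k\<close>: together with the constants, these span \<open>x\<close> and \<open>x\<^sup>2\<close>.\<close>

lemma normal_law_integrable:
  assumes "normal_law N"
  shows "integrable N (\<lambda>x. x)" "integrable N (\<lambda>x. x\<^sup>2)"
proof -
  have "integrable N (\<lambda>x. x) \<and> integrable N (\<lambda>x. x\<^sup>2)"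
    using assms unfolding normal_law_def
  proof (elim disjE exE conjE)
    fix \<mu> assume N: "N = return borel \<mu>"
    interpret prob_space N unfolding N by (rule prob_space_return) simp
    have [measurable_cong]: "sets N = sets borel" by (simp add: N)
    have bound: "AE x in N. norm x \<le> \<bar>\<mu>\<bar>" "AE x in N. norm (x\<^sup>2) \<le> \<mu>\<^sup>2"
      unfolding N by (subst AE_return; simp)+
    have "integrable N (\<lambda>x. x)"
      by (rule integrable_const_bound[OF bound(1)]) measurable
    moreover have "integrable N (\<lambda>x. x\<^sup>2)"
      by (rule integrable_const_bound[OF bound(2)]) measurable
    ultimately show ?thesis by simp
  next
    fix \<mu> \<sigma> :: real assume \<sigma>: "\<sigma> > 0" and N: "N = density lborel (normal_density \<mu> \<sigma>)"
    interpret prob_space N unfolding N by (rule prob_space_normal_density) (rule \<sigma>)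
    have moment: "integrable N (\<lambda>x. (x - \<mu>) ^ k)" for k
      using integrable_normal_moment[OF \<sigma>, of \<mu> k]
      by (simp add: N integrable_density)
    have "integrable N (\<lambda>x. (x - \<mu>) ^ 1 + \<mu>)"
      by (intro Bochner_Integration.integrable_add moment integrable_const)
    moreover have "integrable N (\<lambda>x. (x - \<mu>)\<^sup>2 + 2 * \<mu> * (x - \<mu>) ^ 1 + \<mu>\<^sup>2)"
      by (intro Bochner_Integration.integrable_add integrable_mult_right moment integrable_const)
    then have "integrable N (\<lambda>x. x\<^sup>2)"
      by (simp add: power2_eq_square algebra_simps)
    ultimately show ?thesis by simp
  qed
  then show "integrable N (\<lambda>x. x)" "integrable N (\<lambda>x. x\<^sup>2)" by auto
qed

lemma centred_normal_law_cases:
  assumes "normal_law N" and "(\<integral>x. x \<partial>N) = 0"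
  shows "N = return borel 0 \<and> (\<integral>x. x\<^sup>2 \<partial>N) = 0 \<or>
    (\<exists>\<sigma>>0. N = density lborel (normal_density 0 \<sigma>) \<and> (\<integral>x. x\<^sup>2 \<partial>N) = \<sigma>\<^sup>2)"
  using assms(1) unfolding normal_law_def
proof (elim disjE exE conjE)
  fix \<mu> assume "N = return borel \<mu>"
  then show ?thesis using assms(2) by (simp add: integral_return)
next
  fix \<mu> \<sigma> :: real assume \<sigma>: "\<sigma> > 0" and N: "N = density lborel (normal_density \<mu> \<sigma>)"
  interpret prob_space N unfolding N by (rule prob_space_normal_density) (rule \<sigma>)
  have D: "distributed N lborel (\<lambda>x. x) (normal_density \<mu> \<sigma>)"
    unfolding distributed_def using distr_id2[of lborel N] by (simp add: N)
  have "\<mu> = 0"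
    using normal_distributed_expectation[OF \<sigma> D] assms(2) by simp
  then show ?thesis
    using normal_distributed_variance[OF \<sigma> D] assms(2) \<sigma> N by auto
qed

text \<open>The degenerate law is the one with second moment \<open>0\<close>, so the second moment also
  tells apart the two kinds of normal law.\<close>

lemma centred_normal_law_eq:
  assumes "normal_law N" "(\<integral>x. x \<partial>N) = 0"
    and "normal_law N'" "(\<integral>x. x \<partial>N') = 0"
    and "(\<integral>x. x\<^sup>2 \<partial>N) = (\<integral>x. x\<^sup>2 \<partial>N')"
  shows "N = N'"
  using centred_normal_law_cases[OF assms(1,2)]
proof (elim disjE exE conjE)
  assume "N = return borel 0" "(\<integral>x. x\<^sup>2 \<partial>N) = 0"
  then show ?thesis
    using centred_normal_law_cases[OF assms(3,4)] assms(5) by fastforce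
next
  fix \<sigma> :: real
  assume \<sigma>: "\<sigma> > 0" and N: "N = density lborel (normal_density 0 \<sigma>)" "(\<integral>x. x\<^sup>2 \<partial>N) = \<sigma>\<^sup>2"
  have "(\<integral>x. x\<^sup>2 \<partial>N') \<noteq> 0"
    unfolding assms(5)[symmetric] N(2) using \<sigma> by simp
  then obtain \<tau> where \<tau>: "\<tau> > 0" and N': "N' = density lborel (normal_density 0 \<tau>)"
      "(\<integral>x. x\<^sup>2 \<partial>N') = \<tau>\<^sup>2"
    using centred_normal_law_cases[OF assms(3,4)] by blast
  have "\<sigma>\<^sup>2 = \<tau>\<^sup>2" using N(2) N'(2) assms(5) by simp
  then have "\<sigma> = \<tau>" using \<sigma> \<tau> by (simp add: power2_eq_iff_nonneg)
  then show ?thesis using N(1) N'(1) by simp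
qed

lemma gaussian_process_normal_combination:
  assumes "gaussian_process P I X" and "finite J" "J \<subseteq> I"
  shows "normal_law (distr P borel (\<lambda>\<omega>. \<Sum>k\<in>J. c k * X k \<omega>))"
  using assms unfolding gaussian_process_def by blast

lemma gaussian_process_coordinate:
  assumes "gaussian_process P I X" and "i \<in> I"
  shows "integrable P (X i)" "integrable P (\<lambda>\<omega>. (X i \<omega>)\<^sup>2)"
proof -
  have meas[measurable]: "X i \<in> borel_measurable P"
    using assms by (simp add: gaussian_process_def)
  have N: "normal_law (distr P borel (X i))"
    using gaussian_process_normal_combination[OF assms(1), of "{i}" "\<lambda>_. 1"] assms(2) by simp
  show "integrable P (X i)"
    by (rule integrable_distr[OF meas normal_law_integrable(1)[OF N]])
  show "integrable P (\<lambda>\<omega>. (X i \<omega>)\<^sup>2)"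
    by (rule integrable_distr[OF meas normal_law_integrable(2)[OF N]])
qed

lemma gaussian_process_diff_normal:
  assumes "gaussian_process P I X" and "i \<in> I" "j \<in> I"
  shows "normal_law (distr P borel (\<lambda>\<omega>. X i \<omega> - X j \<omega>))"
proof -
  note lin = gaussian_process_normal_combination[OF assms(1)]
  show ?thesis
  proof (cases "i = j")
    case True
    \<comment> \<open>The two coefficients fall on the same coordinate and cancel:
      this is the empty combination.\<close>
    then show ?thesis using lin[of "{}"] by simp
  next
    case False
    then show ?thesis
      using lin[of "{i, j}" "\<lambda>k. if k = i then 1 else -1"] assms(2,3) by simp
  qed
qed

text \<open>The covariance is built so that \<open>(U, W) \<mapsto> X U - X W\<close> has the power \<open>2H\<close> of the measure
  of the symmetric difference as its variogram. The inclusion \<open>W \<subseteq> U\<close> of an increment only serves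
  to turn that symmetric difference into a set difference.\<close>

lemma sifBm_diff_moments:
  assumes X: "sifBm P m \<A> H X" and U: "U \<in> \<A>" and W: "W \<in> \<A>"
  shows "(\<integral>\<omega>. X U \<omega> - X W \<omega> \<partial>P) = 0"
    and "(\<integral>\<omega>. (X U \<omega> - X W \<omega>)\<^sup>2 \<partial>P) = measure m (sym_diff U W) powr (2 * H)"
proof -
  have gp: "gaussian_process P \<A> X"
    and mean: "\<And>V. V \<in> \<A> \<Longrightarrow> (\<integral>\<omega>. X V \<omega> \<partial>P) = 0"
    and cov: "\<And>V V'. V \<in> \<A> \<Longrightarrow> V' \<in> \<A> \<Longrightarrow> (\<integral>\<omega>. X V \<omega> * X V' \<omega> \<partial>P) =
        1/2 * (measure m V powr (2 * H) + measure m V' powr (2 * H)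
               - measure m (sym_diff V V') powr (2 * H))"
    using X by (auto simp: sifBm_def)
  have meas[measurable]: "X U \<in> borel_measurable P" "X W \<in> borel_measurable P"
    using gp U W by (auto simp: gaussian_process_def)
  note int = gaussian_process_coordinate[OF gp U] gaussian_process_coordinate[OF gp W]
  \<comment> \<open>On the diagonal the last term of the covariance is \<open>0 powr (2 * H) = 0\<close>.\<close>
  have sq: "(\<integral>\<omega>. (X V \<omega>)\<^sup>2 \<partial>P) = measure m V powr (2 * H)" if "V \<in> \<A>" for V
    using cov[OF that that] by (simp add: power2_eq_square)
  show "(\<integral>\<omega>. X U \<omega> - X W \<omega> \<partial>P) = 0"
    using int U W by (simp add: mean)
  have prod: "integrable P (\<lambda>\<omega>. X U \<omega> * X W \<omega>)"
  proof (rule Bochner_Integration.integrable_bound)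
    show "integrable P (\<lambda>\<omega>. (X U \<omega>)\<^sup>2 + (X W \<omega>)\<^sup>2)"
      using int by (intro Bochner_Integration.integrable_add)
    have "\<bar>a * b\<bar> \<le> a\<^sup>2 + b\<^sup>2" for a b :: real
      using sum_squares_bound[of "\<bar>a\<bar>" "\<bar>b\<bar>"] zero_le_power2[of a] zero_le_power2[of b]
        abs_ge_zero[of "a * b"]
      by (simp only: abs_mult power2_abs)
    then show "AE \<omega> in P. norm (X U \<omega> * X W \<omega>) \<le> norm ((X U \<omega>)\<^sup>2 + (X W \<omega>)\<^sup>2)"
      by simp
  qed measurable
  have "(\<integral>\<omega>. (X U \<omega> - X W \<omega>)\<^sup>2 \<partial>P) =
      (\<integral>\<omega>. (X U \<omega>)\<^sup>2 + (X W \<omega>)\<^sup>2 - 2 * (X U \<omega> * X W \<omega>) \<partial>P)"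
    by (simp add: power2_diff mult.assoc)
  also have "\<dots> = (\<integral>\<omega>. (X U \<omega>)\<^sup>2 \<partial>P) + (\<integral>\<omega>. (X W \<omega>)\<^sup>2 \<partial>P) - 2 * (\<integral>\<omega>. X U \<omega> * X W \<omega> \<partial>P)"
    using int prod by simp
  also have "\<dots> = measure m (sym_diff U W) powr (2 * H)"
    by (simp only: sq[OF U] sq[OF W] cov[OF U W]) (simp add: field_simps)
  finally show "(\<integral>\<omega>. (X U \<omega> - X W \<omega>)\<^sup>2 \<partial>P) = measure m (sym_diff U W) powr (2 * H)" .
qed

lemma sifBm_increment_law:
  assumes X: "sifBm P m \<A> H X" and D: "is_increment \<A> X C D"
    and Int: "\<And>U V. U \<in> \<A> \<Longrightarrow> V \<in> \<A> \<Longrightarrow> U \<inter> V \<in> \<A>"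
  shows "normal_law (distr P borel D)"
    and "(\<integral>x. x \<partial>distr P borel D) = 0"
    and "(\<integral>x. x\<^sup>2 \<partial>distr P borel D) = measure m C powr (2 * H)"
proof -
  obtain U V where U: "U \<in> \<A>" and V: "V \<in> \<A>" and C: "C = U - V"
    and D_eq: "D = (\<lambda>\<omega>. X U \<omega> - X (U \<inter> V) \<omega>)"
    using D by (auto simp: is_increment_def)
  have W: "U \<inter> V \<in> \<A>" using U V by (rule Int)
  have gp: "gaussian_process P \<A> X" using X by (simp add: sifBm_def)
  have meas[measurable]: "X U \<in> borel_measurable P" "X (U \<inter> V) \<in> borel_measurable P"
    using gp U W by (auto simp: gaussian_process_def)
  have sd: "sym_diff U (U \<inter> V) = C" unfolding C by blast
  show "normal_law (distr P borel D)"
    unfolding D_eq by (rule gaussian_process_diff_normal[OF gp U W])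
  show "(\<integral>x. x \<partial>distr P borel D) = 0"
    using sifBm_diff_moments(1)[OF X U W] by (simp add: D_eq integral_distr)
  show "(\<integral>x. x\<^sup>2 \<partial>distr P borel D) = measure m C powr (2 * H)"
    using sifBm_diff_moments(2)[OF X U W] unfolding sd by (simp add: D_eq integral_distr)
qed

theorem proposition3p6:
  fixes \<A> :: "'a :: polish_space set set"
    and m :: "'a measure"
    and P :: "'w measure"
    and H :: real
    and BH :: "'a set \<Rightarrow> 'w \<Rightarrow> real"
  assumes "locally compact (UNIV :: 'a set)"
    and "sets m = sets borel"
    and "indexing_collection \<A>"
    and "\<And>U. U \<in> \<A> \<Longrightarrow> emeasure m U < \<infinity>"
    and "0 < H" and "H \<le> 1/2"
    and "sifBm P m \<A> H BH"
  shows "C0_increment_stationary P m \<A> BH"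
proof -
  obtain B An g where "indexing_structure \<A> B An g"
    using assms(3) unfolding indexing_collection_def by blast
  then interpret indexing_structure \<A> B An g .
  have Int: "U \<inter> V \<in> \<A>" if "U \<in> \<A>" "V \<in> \<A>" for U V
    using Inter_mem[of "{U, V}"] that by simp
  show ?thesis
    unfolding C0_increment_stationary_def
  proof (intro ballI impI allI, elim conjE)
    fix C C' D D'
    assume eq: "emeasure m C = emeasure m C'"
      and D: "is_increment \<A> BH C D" and D': "is_increment \<A> BH C' D'"
    note law = sifBm_increment_law[OF assms(7) D Int]
    note law' = sifBm_increment_law[OF assms(7) D' Int]
    have "measure m C = measure m C'" using eq by (simp add: measure_def)
    then show "distr P borel D = distr P borel D'"
      by (intro centred_normal_law_eq) (simp_all add: law law')
  qed
qed

end
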